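(* There exists a sequence of real numbers $(\varepsilon_k)_{k\ge 2}$ with $\varepsilon_k\to 0$ as $k\to\infty$ such that for every integer $k\ge 2$ there exist a finite set $Y$ and a union-closed family $\mathcal{F}\subset\mathcal{P}(Y)$ with the following properties: $\mathcal{F}$ has a unique member $S$ of minimum size, $|S|=k$, and every element $x\in S$ has frequency $\gamma_x$ satisfying $$(1-\varepsilon_k)\frac{\log_2 k}{2k}\;\le\;\gamma_x\;\le\;(1+\varepsilon_k)\frac{\log_2 k}{2k}.$$ In other words, each element of the smallest set has frequency $(1+o(1))\frac{\log_2 k}{2k}$.
   Context: A family $\mathcal{F}$ of subsets of a set $Y$ is union-closed if $A\cup B\in\mathcal{F}$ whenever $A,B\in\mathcal{F}$. For a finite nonempty family $\mathcal{F}\subset\mathcal{P}(Y)$ and $x\in Y$, the frequency of $x$ is $\gamma_x=|\{A\in\mathcal{F}: x\in A\}|/|\mathcal{F}|$. The $o(1)$ denotes a quantity tending to $0$ as $k\to\infty$; $\log_2$ is the base-2 logarithm. *)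

theory Defs
  imports Complex_Main
begin

definition union_closed :: "'a set set \<Rightarrow> bool" where
  "union_closed F \<longleftrightarrow> (\<forall>A\<in>F. \<forall>B\<in>F. A \<union> B \<in> F)"

(* Intended for finite nonempty F. *)
definition frequency :: "'a set set \<Rightarrow> 'a \<Rightarrow> real" where
  "frequency F x = real (card {A \<in> F. x \<in> A}) / real (card F)"

(* Sizes are compared by card, so the members of F are meant to be finite sets. *)
definition unique_minimum_member :: "'a set set \<Rightarrow> 'a set \<Rightarrow> bool" where
  "unique_minimum_member F S \<longleftrightarrow>
     S \<in> F \<and> (\<forall>A\<in>F. card S \<le> card A) \<and> (\<forall>A\<in>F. card A = card S \<longrightarrow> A = S)"

end

theory Submission
  imports Defs "HOL-Number_Theory.Cong"
begin

text \<open>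
  Let \<open>S\<close> have \<open>k\<close> elements and give each \<open>i \<in> S\<close> a block \<open>X i\<close> outside \<open>S\<close>; let \<open>U\<close> be the
  union of the disjoint blocks. Besides \<open>S\<close> itself and the negligibly many sets \<open>U \<union> T\<close> with
  \<open>T \<subseteq> S\<close>, the family consists of the sets \<open>(U - D) \<union> T\<close> with \<open>D\<close> a nonempty subset of a single
  block \<open>X i\<close> and with \<open>T = S\<close> or \<open>T \<subseteq> R i\<close>, where \<open>R i \<subseteq> S\<close> has \<open>r = \<lceil>log 2 k\<rceil>\<close> elements. The
  union of two such sets over different blocks contains \<open>U\<close>, so union-closedness only has to be
  checked within one block. The sets \<open>T\<close> allowed over a block are \<open>2 ^ r + 1\<close> in number and have
  average size \<open>(r * 2 ^ (r - 1) + k) / (2 ^ r + 1) = (log 2 k) / 2 + O(1)\<close>; letting \<open>R i\<close> rotate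
  with \<open>i\<close> spreads this size evenly over the elements of \<open>S\<close>.
\<close>

section \<open>Counting subsets through a point, and cyclic rotations\<close>

lemma card_Pow_containing:
  assumes "finite A"
  shows "2 * card {T \<in> Pow A. x \<in> T} = (if x \<in> A then 2 ^ card A else 0)"
proof (cases "x \<in> A")
  case True
  have eq: "{T \<in> Pow A. x \<in> T} = Pow A - Pow (A - {x})"
    by auto
  have "card {T \<in> Pow A. x \<in> T} = 2 ^ card A - 2 ^ card (A - {x})"
    unfolding eq using assms by (subst card_Diff_subset) (auto simp: card_Pow)
  moreover obtain m where "card A = Suc m" "card (A - {x}) = m"
    using card.remove[OF assms True] by blast
  ultimately show ?thesis
    using True by simp
next
  case False
  then have eq: "{T \<in> Pow A. x \<in> T} = {}"
    by auto
  show ?thesis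
    unfolding eq using False by simp
qed

lemma div_fibre_eq_interval:
  fixes m q :: nat
  assumes "0 < m"
  shows "{x. x div m = q} = {m * q..<m * q + m}"
proof (intro set_eqI iffI)
  fix x assume "x \<in> {x. x div m = q}"
  then show "x \<in> {m * q..<m * q + m}"
    using dividend_less_times_div[OF assms, of x] times_div_less_eq_dividend[of m x]
    by (simp add: add.commute)
next
  fix x assume "x \<in> {m * q..<m * q + m}"
  then have "m * q \<le> x" "x < m * Suc q"
    by simp_all
  then show "x \<in> {x. x div m = q}"
    by (simp add: div_nat_eqI)
qed

text \<open>Translation by \<open>i\<close> permutes the residues modulo \<open>k\<close>, so the
  set is the preimage of \<open>{..<r}\<close> under a bijection. The condition is symmetric in
  \<open>i\<close> and \<open>x\<close>, so the same count gives both the size of each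
  \<open>R i\<close> and the number of \<open>i\<close> whose \<open>R i\<close> contains a given
  point.\<close>

lemma card_rotation:
  fixes k r i :: nat
  assumes "r \<le> k"
  shows "card {x. x < k \<and> (i + x) mod k < r} = r"
proof -
  let ?f = "\<lambda>x. (i + x) mod k"
  have inj: "inj_on ?f {..<k}"
  proof (rule inj_onI)
    fix x y assume xy: "x \<in> {..<k}" "y \<in> {..<k}" and "?f x = ?f y"
    then have "[i + x = i + y] (mod k)"
      by (simp add: cong_def)
    then have "[x = y] (mod k)"
      by (simp only: cong_add_lcancel_nat)
    with xy show "x = y"
      by (simp add: cong_def)
  qed
  moreover have "?f ` {..<k} \<subseteq> {..<k}"
    by auto
  ultimately have surj: "?f ` {..<k} = {..<k}"
    by (simp add: endo_inj_surj)
  have "?f ` {x. x < k \<and> ?f x < r} = {..<r}"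
  proof -
    have "y \<in> ?f ` {x. x < k \<and> ?f x < r}" if "y < r" for y
    proof -
      have "y \<in> ?f ` {..<k}"
        using surj that assms by auto
      then show ?thesis
        using that by auto
    qed
    then show ?thesis
      by auto
  qed
  moreover have "inj_on ?f {x. x < k \<and> ?f x < r}"
    using inj by (rule inj_on_subset) auto
  ultimately show ?thesis
    using card_image[of ?f "{x. x < k \<and> ?f x < r}"] by simp
qed

section \<open>The block construction\<close>

text \<open>\<open>card_less\<close> makes every set containing a whole block larger than
  \<open>S\<close>. Properness of \<open>R i\<close> keeps \<open>S\<close> out of
  \<open>Pow (R i)\<close>. \<open>card_R_containing\<close> is the regularity that gives all
  elements of \<open>S\<close> the same frequency.\<close>

locale block_family =
  fixes S :: "'a set" and X R :: "'a \<Rightarrow> 'a set" and n r :: nat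
  assumes two_le_card: "2 \<le> card S"
    and card_block: "i \<in> S \<Longrightarrow> card (X i) = n"
    and card_less: "card S < n"
    and block_disjoint: "i \<in> S \<Longrightarrow> j \<in> S \<Longrightarrow> i \<noteq> j \<Longrightarrow> X i \<inter> X j = {}"
    and block_outside: "i \<in> S \<Longrightarrow> X i \<inter> S = {}"
    and R_subset: "i \<in> S \<Longrightarrow> R i \<subset> S"
    and card_R: "i \<in> S \<Longrightarrow> card (R i) = r"
    and card_R_containing: "x \<in> S \<Longrightarrow> card {i \<in> S. x \<in> R i} = r"
begin

definition U :: "'a set" where
  "U = (\<Union>i\<in>S. X i)"

definition Q :: "'a \<Rightarrow> 'a set set" where
  "Q i = insert S (Pow (R i))"

text \<open>A pair \<open>(D, T)\<close> encodes the member \<open>(U - D) \<union> T\<close>, and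
  \<open>(U, S)\<close> encodes \<open>S\<close> itself. \<open>W\<close> and \<open>V\<close> are
  left free so that one count serves the whole family and its subfamily through a given
  point.\<close>

definition indices :: "'a set set \<Rightarrow> ('a \<Rightarrow> 'a set set) \<Rightarrow> ('a set \<times> 'a set) set" where
  "indices W V = insert (U, S) ({{}} \<times> W \<union> (\<Union>i\<in>S. (Pow (X i) - {{}}) \<times> V i))"

definition member :: "'a set \<times> 'a set \<Rightarrow> 'a set" where
  "member p = (U - fst p) \<union> snd p"

definition family :: "'a set set" where
  "family = member ` indices (Pow S) Q"

lemma finite_S: "finite S"
  using two_le_card by (metis card.infinite not_numeral_le_zero)

lemma finite_block: "i \<in> S \<Longrightarrow> finite (X i)"
  using card_block card_less by (metis card.infinite not_less_zero)

lemma finite_U: "finite U"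
  unfolding U_def using finite_S finite_block by auto

lemma finite_R: "i \<in> S \<Longrightarrow> finite (R i)"
  using R_subset finite_S by (meson finite_subset psubset_imp_subset)

lemma U_outside: "U \<inter> S = {}"
  unfolding U_def using block_outside by auto

lemma block_subset_U: "i \<in> S \<Longrightarrow> X i \<subseteq> U"
  unfolding U_def by auto

lemma block_nonempty: "i \<in> S \<Longrightarrow> X i \<noteq> {}"
  using card_block card_less by (metis card.empty not_less_zero)

lemma other_index: obtains j where "j \<in> S" "j \<noteq> i"
proof -
  have "\<not> S \<subseteq> {i}"
  proof
    assume "S \<subseteq> {i}"
    then have "card S \<le> card {i}"
      by (intro card_mono) auto
    with two_le_card show False
      by simp
  qed
  with that show thesis
    by auto
qed

lemma U_nonempty: "U \<noteq> {}"
  using other_index block_subset_U block_nonempty by (metis subset_empty)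

lemma U_not_subset_block:
  assumes i: "i \<in> S"
  shows "\<not> U \<subseteq> X i"
proof -
  obtain j where j: "j \<in> S" "j \<noteq> i"
    by (rule other_index)
  then show ?thesis
    using i block_disjoint[OF i j(1)] block_subset_U[OF j(1)] block_nonempty[OF j(1)] by auto
qed

lemma Q_subset: "i \<in> S \<Longrightarrow> Q i \<subseteq> Pow S"
  unfolding Q_def using R_subset by auto

lemma Q_union: "T \<in> Q i \<Longrightarrow> T' \<in> Q i \<Longrightarrow> i \<in> S \<Longrightarrow> T \<union> T' \<in> Q i"
  unfolding Q_def using R_subset by (auto simp: sup_absorb1 sup_absorb2)

lemma indices_subset: "indices (Pow S) Q \<subseteq> Pow U \<times> Pow S"
proof -
  have "(Pow (X i) - {{}}) \<times> Q i \<subseteq> Pow U \<times> Pow S" if "i \<in> S" for i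
    using Q_subset[OF that] block_subset_U[OF that] by (intro Sigma_mono) auto
  then show ?thesis
    unfolding indices_def by auto
qed

section \<open>Counting members of the family\<close>

lemma inj_on_member: "inj_on member (Pow U \<times> Pow S)"
proof (rule inj_onI)
  fix p q assume p: "p \<in> Pow U \<times> Pow S" and q: "q \<in> Pow U \<times> Pow S"
    and eq: "member p = member q"
  have "fst p = U - member p" "snd p = member p \<inter> S" "fst q = U - member q" "snd q = member q \<inter> S"
    using p q U_outside unfolding member_def by (auto, blast+)
  with eq show "p = q"
    by (simp add: prod_eq_iff)
qed

lemma card_indices:
  assumes W: "W \<subseteq> Pow S" and V: "\<And>i. i \<in> S \<Longrightarrow> V i \<subseteq> Pow S"
  shows "card (indices W V) = 1 + card W + (2 ^ n - 1) * (\<Sum>i\<in>S. card (V i))"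
proof -
  let ?B = "\<lambda>i. (Pow (X i) - {{}}) \<times> V i"
  have finW: "finite W" and finV: "i \<in> S \<Longrightarrow> finite (V i)" for i
    using W V finite_S by (meson finite_Pow_iff finite_subset)+
  have "card (\<Union>i\<in>S. ?B i) = (\<Sum>i\<in>S. card (?B i))"
  proof (rule card_UN_disjoint)
    show "\<forall>i\<in>S. finite (?B i)"
      using finV finite_block by auto
    show "\<forall>i\<in>S. \<forall>j\<in>S. i \<noteq> j \<longrightarrow> ?B i \<inter> ?B j = {}"
      using block_disjoint by (auto, blast)
  qed (fact finite_S)
  also have "\<dots> = (\<Sum>i\<in>S. (2 ^ n - 1) * card (V i))"
  proof (rule sum.cong)
    fix i assume "i \<in> S"
    then have "card (Pow (X i) - {{}}) = 2 ^ n - 1"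
      using finite_block card_block by (simp add: card_Diff_subset card_Pow)
    then show "card (?B i) = (2 ^ n - 1) * card (V i)"
      by (simp add: card_cartesian_product)
  qed simp
  finally have "card (\<Union>i\<in>S. ?B i) = (2 ^ n - 1) * (\<Sum>i\<in>S. card (V i))"
    by (simp add: sum_distrib_left)
  moreover have "card ({{}} \<times> W \<union> (\<Union>i\<in>S. ?B i)) = card W + card (\<Union>i\<in>S. ?B i)"
    using finW finV finite_S finite_block
    by (subst card_Un_disjoint) (auto simp: card_cartesian_product)
  \<comment> \<open>There are at least two nonempty disjoint blocks, so \<open>U\<close> fits into
    no single block.\<close>
  moreover have "(U, S) \<notin> {{}} \<times> W \<union> (\<Union>i\<in>S. ?B i)"
    using U_not_subset_block U_nonempty by auto
  moreover have "finite ({{}} \<times> W \<union> (\<Union>i\<in>S. ?B i))"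
    using finW finV finite_S finite_block by auto
  ultimately show ?thesis
    unfolding indices_def by simp
qed

lemma card_family: "card family = 1 + 2 ^ card S + (2 ^ n - 1) * (card S * (2 ^ r + 1))"
proof -
  have "card (Q i) = 2 ^ r + 1" if "i \<in> S" for i
  proof -
    have "S \<notin> Pow (R i)"
      using that R_subset by auto
    then show ?thesis
      unfolding Q_def using finite_R that card_R by (simp add: card_Pow)
  qed
  then have "(\<Sum>i\<in>S. card (Q i)) = card S * (2 ^ r + 1)"
    by simp
  moreover have "card family = card (indices (Pow S) Q)"
    unfolding family_def
    using inj_on_member indices_subset by (metis card_image inj_on_subset)
  ultimately show ?thesis
    using card_indices[of "Pow S" Q] Q_subset finite_S by (simp add: card_Pow)
qed

text \<open>Over each block, \<open>S\<close> contributes one set through \<open>x\<close>, and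
  \<open>Pow (R i)\<close> contributes half of its sets exactly when \<open>x \<in> R i\<close>,
  which happens for \<open>r\<close> indices. Hence the count does not depend on \<open>x\<close>.
  Doubling avoids the exponent \<open>r - 1\<close>.\<close>

lemma card_family_containing:
  assumes x: "x \<in> S"
  shows "2 * card {A \<in> family. x \<in> A}
    = 2 + 2 ^ card S + (2 ^ n - 1) * (2 * card S + r * 2 ^ r)"
proof -
  let ?W = "{T \<in> Pow S. x \<in> T}" and ?V = "\<lambda>i. {T \<in> Q i. x \<in> T}"
  have "x \<in> member p \<longleftrightarrow> x \<in> snd p" for p
    using x U_outside unfolding member_def by auto
  then have "{A \<in> family. x \<in> A} = member ` {p \<in> indices (Pow S) Q. x \<in> snd p}"
    unfolding family_def by auto
  also have "{p \<in> indices (Pow S) Q. x \<in> snd p} = indices ?W ?V"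
    unfolding indices_def using x by auto
  finally have "card {A \<in> family. x \<in> A} = card (member ` indices ?W ?V)"
    by simp
  also have "\<dots> = card (indices ?W ?V)"
  proof (rule card_image, rule inj_on_subset[OF inj_on_member])
    have "indices ?W ?V \<subseteq> indices (Pow S) Q"
      unfolding indices_def by auto
    then show "indices ?W ?V \<subseteq> Pow U \<times> Pow S"
      using indices_subset by blast
  qed
  also have "\<dots> = 1 + card ?W + (2 ^ n - 1) * (\<Sum>i\<in>S. card (?V i))"
    using Q_subset by (intro card_indices) auto
  finally have card: "card {A \<in> family. x \<in> A} = \<dots>" .
  have "2 * card (?V i) = 2 + (if x \<in> R i then 2 ^ r else 0)" if i: "i \<in> S" for i
  proof -
    have "?V i = insert S {T \<in> Pow (R i). x \<in> T}"
      unfolding Q_def using x by auto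
    moreover have "S \<notin> {T \<in> Pow (R i). x \<in> T}"
      using i R_subset by auto
    ultimately have "card (?V i) = Suc (card {T \<in> Pow (R i). x \<in> T})"
      using finite_R[OF i] by simp
    then show ?thesis
      using card_Pow_containing[OF finite_R[OF i], of x] card_R[OF i] by simp
  qed
  then have "2 * (\<Sum>i\<in>S. card (?V i)) = (\<Sum>i\<in>S. 2 + (if x \<in> R i then 2 ^ r else 0))"
    by (simp add: sum_distrib_left)
  also have "\<dots> = 2 * card S + r * 2 ^ r"
    unfolding sum.distrib using finite_S card_R_containing[OF x]
    by (simp add: sum.If_cases Int_def)
  finally have "2 * (\<Sum>i\<in>S. card (?V i)) = 2 * card S + r * 2 ^ r" .
  moreover have "2 * card ?W = 2 ^ card S"
    using card_Pow_containing[OF finite_S, of x] x by simp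
  moreover have "2 * card {A \<in> family. x \<in> A}
      = 2 + 2 * card ?W + (2 ^ n - 1) * (2 * (\<Sum>i\<in>S. card (?V i)))"
    unfolding card by (simp only: distrib_left mult_1_right mult.left_commute[of 2 "2 ^ n - 1"])
  ultimately show ?thesis
    by (simp only:)
qed

section \<open>Union-closedness and the unique minimum\<close>

lemma member_cases:
  assumes "A \<in> family"
  obtains (bottom) "A = S"
  | (top) T where "T \<subseteq> S" "A = U \<union> T"
  | (block) i D T where "i \<in> S" "D \<subseteq> X i" "T \<in> Q i" "A = (U - D) \<union> T"
proof -
  obtain p where p: "p \<in> indices (Pow S) Q" "A = member p"
    using assms unfolding family_def by auto
  then consider "p = (U, S)" | "fst p = {}" "snd p \<subseteq> S"
    | i where "i \<in> S" "fst p \<subseteq> X i" "snd p \<in> Q i"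
    unfolding indices_def by auto
  then show thesis
    using p(2) bottom top block unfolding member_def by cases auto
qed

lemma bottom_in_family: "S \<in> family"
proof -
  have "member (U, S) = S"
    by (simp add: member_def)
  moreover have "(U, S) \<in> indices (Pow S) Q"
    by (simp add: indices_def)
  ultimately show ?thesis
    unfolding family_def by force
qed

lemma top_in_family: "T \<subseteq> S \<Longrightarrow> U \<union> T \<in> family"
  unfolding family_def by (rule image_eqI[of _ _ "({}, T)"]) (auto simp: member_def indices_def)

lemma block_in_family:
  assumes "i \<in> S" "D \<subseteq> X i" "T \<in> Q i"
  shows "(U - D) \<union> T \<in> family"
proof (cases "D = {}")
  case True
  then show ?thesis
    using top_in_family Q_subset assms by auto
next
  case False
  then show ?thesis
    unfolding family_def using assms
    by (intro image_eqI[of _ _ "(D, T)"]) (auto simp: member_def indices_def)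
qed

lemma family_subset: "A \<in> family \<Longrightarrow> A \<subseteq> U \<union> S"
  by (erule member_cases) (use Q_subset in auto)

text \<open>All sets \<open>U \<union> T\<close> with \<open>T \<subseteq> S\<close> are members, so
  they absorb every union that covers \<open>U\<close>.\<close>

lemma above_U_in_family:
  assumes "A \<in> family" "B \<in> family" "U \<subseteq> A \<union> B"
  shows "A \<union> B \<in> family"
proof -
  have "A \<union> B = U \<union> ((A \<union> B) \<inter> S)"
    using assms family_subset by blast
  then show ?thesis
    using top_in_family by (metis inf_le2)
qed

text \<open>Adding \<open>S\<close> keeps the removed part \<open>D\<close> and replaces
  \<open>T\<close> by \<open>S\<close>; this is why \<open>S\<close> belongs to every
  \<open>Q i\<close>.\<close>

lemma union_bottom_in_family:
  assumes "A \<in> family"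
  shows "A \<union> S \<in> family"
  using assms
proof (cases rule: member_cases)
  case (block i D T)
  then have "A \<union> S = (U - D) \<union> S"
    using Q_subset by blast
  moreover have "S \<in> Q i"
    by (simp add: Q_def)
  ultimately show ?thesis
    using block_in_family block by metis
qed (use assms bottom_in_family above_U_in_family in auto)

lemma union_closed_family: "union_closed family"
  unfolding union_closed_def
proof (intro ballI)
  fix A B assume A: "A \<in> family" and B: "B \<in> family"
  show "A \<union> B \<in> family"
    using A
  proof (cases rule: member_cases)
    case bottom
    then show ?thesis
      using union_bottom_in_family[OF B] by (simp add: Un_commute)
  next
    case (top T)
    then show ?thesis
      using above_U_in_family A B by auto
  next
    case a: (block i D T)
    show ?thesis
      using B
    proof (cases rule: member_cases)
      case bottom
      then show ?thesis
        using union_bottom_in_family[OF A] by simp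
    next
      case (top T)
      then show ?thesis
        using above_U_in_family A B by auto
    next
      case b: (block j D' T')
      show ?thesis
      proof (cases "i = j")
        case True
        have "A \<union> B = (U - D \<inter> D') \<union> (T \<union> T')"
          using a b by auto
        moreover have "T \<union> T' \<in> Q i"
          using a b True Q_union by auto
        moreover have "D \<inter> D' \<subseteq> X i"
          using a by auto
        ultimately show ?thesis
          using block_in_family a by metis
      next
        case False
        then have "X i \<inter> X j = {}"
          using a b block_disjoint by auto
        \<comment> \<open>\<open>A\<close> and \<open>B\<close> miss points of \<open>U\<close> only
          in disjoint blocks, so no point is missed by both.\<close>
        then have "U \<subseteq> A \<union> B"
          using a b by auto
        then show ?thesis
          using above_U_in_family A B by auto
      qed
    qed
  qed
qed

text \<open>A member other than \<open>S\<close> loses points from at most one block, so it contains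
  another block entirely, and a block already has more than \<open>card S\<close> points.\<close>

lemma card_S_less:
  assumes "A \<in> family" "A \<noteq> S"
  shows "card S < card A"
proof -
  obtain j where j: "j \<in> S" "X j \<subseteq> A"
    using assms(1)
  proof (cases rule: member_cases)
    case bottom
    then show thesis
      using assms(2) by simp
  next
    case (top T)
    then show thesis
      using other_index that block_subset_U by (metis le_supI1)
  next
    case (block i D T)
    obtain j where j: "j \<in> S" "j \<noteq> i"
      by (rule other_index)
    then have "X i \<inter> X j = {}"
      using block block_disjoint by auto
    then have "X j \<subseteq> A"
      using block block_subset_U[OF j(1)] by auto
    with j that show thesis
      by auto
  qed
  have "finite A"
    using assms(1) family_subset finite_S finite_U by (meson finite_UnI finite_subset)
  then have "n \<le> card A"
    using j card_block by (metis card_mono)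
  with card_less show ?thesis
    by simp
qed

lemma unique_minimum_family: "unique_minimum_member family S"
  unfolding unique_minimum_member_def
  using bottom_in_family card_S_less by (metis less_le less_irrefl order_refl)

lemma frequency_family:
  assumes "x \<in> S"
  shows "frequency family x
    = (2 + 2 ^ card S + (2 ^ n - 1) * (2 * real (card S) + real r * 2 ^ r))
      / (2 * (1 + 2 ^ card S + (2 ^ n - 1) * (real (card S) * (2 ^ r + 1))))"
proof -
  have N: "real (2 ^ n - 1) = 2 ^ n - 1"
    by simp
  have "2 * real (card {A \<in> family. x \<in> A})
      = 2 + 2 ^ card S + (2 ^ n - 1) * (2 * real (card S) + real r * 2 ^ r)"
    using arg_cong[OF card_family_containing[OF assms], of real] N by simp
  moreover have "2 * real (card family) = 2 * (1 + 2 ^ card S + (2 ^ n - 1) * (real (card S) * (2 ^ r + 1)))"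
    using arg_cong[OF card_family, of real] N by (simp add: distrib_left)
  moreover have "frequency family x = (2 * real (card {A \<in> family. x \<in> A})) / (2 * real (card family))"
    by (simp add: frequency_def)
  ultimately show ?thesis
    by (simp only:)
qed

end

section \<open>Estimating the frequency\<close>

text \<open>Here \<open>L\<close>, \<open>M\<close>, \<open>N\<close>, \<open>W\<close> stand for
  \<open>log 2 k\<close>, \<open>2 ^ r\<close>, \<open>2 ^ n - 1\<close>, \<open>2 ^ k\<close>. Both
  bounds amount to \<open>k * a\<close> differing from \<open>L * b\<close> by at most
  \<open>5 * b\<close>. The 5 comes from the upper bound: 4 from lower-order terms and 1 from
  rounding \<open>L\<close> up to \<open>r\<close>.\<close>

lemma count_ratio_bounds:
  fixes k r L M N W :: real
  assumes k: "2 \<le> k" and L: "0 < L" "L \<le> r" "r \<le> L + 1" and M: "k \<le> M" "r \<le> M"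
    and W: "0 \<le> W" "1 + W \<le> N"
  defines "a \<equiv> 2 + W + N * (2 * k + r * M)" and "b \<equiv> 1 + W + N * (k * (M + 1))"
  shows "(1 - 5 / L) * (L / (2 * k)) \<le> a / (2 * b)"
    and "a / (2 * b) \<le> (1 + 5 / L) * (L / (2 * k))"
proof -
  have N: "1 \<le> N"
    using W by simp
  have b: "0 < b"
    unfolding b_def using W N k M by (auto intro!: add_pos_nonneg)
  have kMb: "N * (k * (M + 1)) \<le> b"
    unfolding b_def using W by simp
  have "r * b \<le> k * a + 5 * b"
  proof -
    have "r * (1 + W) \<le> M * N"
      using M W L N by (intro mult_mono) auto
    also have "\<dots> \<le> N * (k * (M + 1))"
    proof -
      have "1 * M \<le> k * (M + 1)"
        using k M by (intro mult_mono) auto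
      then show ?thesis
        using N by (simp add: mult.commute mult_left_mono)
    qed
    finally have 1: "r * (1 + W) \<le> b"
      using kMb by simp
    have "N * k * r \<le> N * k * (M + 1)"
      using N k M by (intro mult_left_mono) auto
    then have 2: "N * k * r \<le> b"
      using kMb by (simp add: mult.assoc)
    have 3: "k * (N * (r * M)) \<le> k * a"
      unfolding a_def using k W N by (intro mult_left_mono) (auto simp: algebra_simps)
    have "r * b = r * (1 + W) + N * k * r + k * (N * (r * M))"
      unfolding b_def by (simp add: algebra_simps)
    with 1 2 3 b show ?thesis
      by linarith
  qed
  moreover have "L * b \<le> r * b"
    using L b by simp
  ultimately have lower: "(L - 5) * b \<le> k * a"
    by (simp add: algebra_simps)
  \<comment> \<open>\<open>2 + W \<le> 2 * N\<close> follows from \<open>1 + W \<le> N\<close> and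
    \<open>1 \<le> N\<close>.\<close>
  have "a \<le> N * (2 + 2 * k + r * M)"
    unfolding a_def using W N by (simp add: algebra_simps)
  also have "\<dots> \<le> N * ((r + 4) * (M + 1))"
    using N k M L by (intro mult_left_mono) (auto simp: algebra_simps)
  finally have "k * a \<le> k * (N * ((r + 4) * (M + 1)))"
    using k by simp
  also have "\<dots> = (r + 4) * (N * (k * (M + 1)))"
    by (simp add: algebra_simps)
  also have "\<dots> \<le> (r + 4) * b"
    using kMb L by (intro mult_left_mono) auto
  also have "\<dots> \<le> (L + 5) * b"
    using L b by (intro mult_right_mono) auto
  finally have upper: "k * a \<le> (L + 5) * b" .
  have "(1 - 5 / L) * (L / (2 * k)) = (L - 5) / (2 * k)"
    and "(1 + 5 / L) * (L / (2 * k)) = (L + 5) / (2 * k)"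
    using L k by (simp_all add: field_simps)
  then show "(1 - 5 / L) * (L / (2 * k)) \<le> a / (2 * b)"
    and "a / (2 * b) \<le> (1 + 5 / L) * (L / (2 * k))"
    using lower upper b k by (simp_all add: frac_le_eq divide_le_eq le_divide_eq field_simps)
qed

lemma log2_bounding_exponent:
  fixes k :: nat
  assumes "2 \<le> k"
  obtains r where "r < k" "k \<le> 2 ^ r" "log 2 k \<le> r" "r \<le> log 2 k + 1"
proof -
  define r where "r = nat \<lceil>log 2 k\<rceil>"
  have L: "0 < log 2 k"
    using assms by simp
  have r: "log 2 k \<le> r" "r < log 2 k + 1"
    unfolding r_def using L by linarith+
  have "k = 2 powr (log 2 k)"
    using assms by simp
  also have "\<dots> \<le> 2 powr r"
    using r by simp
  finally have "k \<le> 2 ^ r"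
    by (simp add: powr_realpow)
  moreover have "r < k"
  proof -
    \<comment> \<open>The second conjunct is the goal; the first is its successor instance and
      carries the induction.\<close>
    have "Suc k \<le> 2 ^ k \<and> k \<le> 2 ^ (k - 1)"
      using assms by (induction k rule: dec_induct) (auto simp: numeral_2_eq_2 le_diff_conv)
    then have "log 2 k \<le> log 2 (2 ^ (k - 1))"
      using assms by (intro log_mono) (auto simp: of_nat_le_numeral_power_cancel_iff)
    then show ?thesis
      using r(2) assms by (simp add: log_nat_power of_nat_diff)
  qed
  ultimately show thesis
    using that r by (simp add: less_imp_le)
qed

section \<open>Realization on the natural numbers\<close>

text \<open>The blocks are consecutive intervals of length \<open>k + 1\<close>; the shift to
  quotient \<open>i + 1\<close> keeps them away from \<open>{..<k}\<close>, where the quotient is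
  0.\<close>

lemma block_family_nat:
  fixes k r :: nat
  assumes k: "2 \<le> k" and r: "r < k"
  shows "block_family {..<k} (\<lambda>i. {x. x div (k + 1) = i + 1})
    (\<lambda>i. {x. x < k \<and> (i + x) mod k < r}) (k + 1) r"
proof
  fix i
  show "card {x. x div (k + 1) = i + 1} = k + 1"
    by (subst div_fibre_eq_interval) auto
  have card: "card {x. x < k \<and> (i + x) mod k < r} = r"
    using card_rotation[of r k i] r by simp
  then show "card {x. x < k \<and> (i + x) mod k < r} = r" .
  have "{x. x < k \<and> (i + x) mod k < r} \<noteq> {..<k}"
    using card r by (metis card_lessThan less_irrefl)
  then show "{x. x < k \<and> (i + x) mod k < r} \<subset> {..<k}"
    by auto
  show "card {j \<in> {..<k}. i \<in> {x. x < k \<and> (j + x) mod k < r}} = r" if "i \<in> {..<k}"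
    using card that by (simp add: add.commute)
qed (use k in auto)

theorem theorem1:
  shows "\<exists>\<epsilon> :: nat \<Rightarrow> real. \<epsilon> \<longlonglongrightarrow> 0 \<and>
    (\<forall>k\<ge>2. \<exists>(Y :: nat set) (F :: nat set set) (S :: nat set).
        finite Y \<and> F \<subseteq> Pow Y \<and> union_closed F \<and>
        unique_minimum_member F S \<and> card S = k \<and>
        (\<forall>x\<in>S.
           (1 - \<epsilon> k) * (log 2 (real k) / (2 * real k)) \<le> frequency F x \<and>
           frequency F x \<le> (1 + \<epsilon> k) * (log 2 (real k) / (2 * real k))))"
proof (intro exI[of _ "\<lambda>k. 5 / log 2 (real k)"] conjI allI impI)
  have "filterlim (\<lambda>k. ln (real k)) at_top sequentially"
    using ln_at_top filterlim_real_sequentially by (rule filterlim_compose)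
  then have "(\<lambda>k. 5 * ln 2 / ln (real k)) \<longlonglongrightarrow> 0"
    by (intro real_tendsto_divide_at_top) auto
  then show "(\<lambda>k. 5 / log 2 (real k)) \<longlonglongrightarrow> 0"
    by (simp add: log_def)
next
  fix k :: nat
  assume k: "2 \<le> k"
  then obtain r where r: "r < k" "k \<le> 2 ^ r" "log 2 k \<le> r" "r \<le> log 2 k + 1"
    by (rule log2_bounding_exponent)
  interpret block_family "{..<k}" "\<lambda>i. {x. x div (k + 1) = i + 1}"
    "\<lambda>i. {x. x < k \<and> (i + x) mod k < r}" "k + 1" r
    using k r(1) by (rule block_family_nat)
  \<comment> \<open>These are the hypotheses of \<open>count_ratio_bounds\<close>; the third,
    \<open>1 + W \<le> N\<close>, holds because blocks have \<open>k + 1\<close> points.\<close>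
  have "real k \<le> 2 ^ r" "real r \<le> 2 ^ r" "1 + 2 ^ k \<le> (2 ^ (k + 1) - 1 :: real)" "0 < log 2 k"
    using r(2) k of_nat_less_two_power[of r, where 'a = real] self_le_power[of "2::real" k]
    by (auto simp: of_nat_le_numeral_power_cancel_iff)
  then have bounds: "(1 - 5 / log 2 k) * (log 2 k / (2 * real k)) \<le> frequency family x \<and>
      frequency family x \<le> (1 + 5 / log 2 k) * (log 2 k / (2 * real k))" if "x \<in> {..<k}" for x
    unfolding frequency_family[OF that] card_lessThan using k r
    by (intro conjI count_ratio_bounds) auto
  have "finite (U \<union> {..<k})" "family \<subseteq> Pow (U \<union> {..<k})"
    using finite_U family_subset by auto
  with bounds union_closed_family unique_minimum_family
  show "\<exists>(Y :: nat set) (F :: nat set set) (S :: nat set).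
        finite Y \<and> F \<subseteq> Pow Y \<and> union_closed F \<and>
        unique_minimum_member F S \<and> card S = k \<and>
        (\<forall>x\<in>S.
           (1 - 5 / log 2 (real k)) * (log 2 (real k) / (2 * real k)) \<le> frequency F x \<and>
           frequency F x \<le> (1 + 5 / log 2 (real k)) * (log 2 (real k) / (2 * real k)))"
    by (intro exI[of _ "U \<union> {..<k}"] exI[of _ family] exI[of _ "{..<k}"]) auto
qed

end
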